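(* Let $(L,\cdot)$ be a quasigroup (respectively, a loop) with holomorph $H(L)$. If $H(L)$ is an AIPQ (respectively, an AIPL) or a CIPQ (respectively, a CIPL), then $H(L)\cong L$.
   Context: Mappings are written on the right of their arguments and composed from left to right. A quasigroup $(L,\cdot)$ is a non-empty set with a binary operation such that for all $a,b\in L$ the equations $a\cdot x=b$ and $y\cdot a=b$ have unique solutions $x,y\in L$; a loop is a quasigroup with a two-sided identity element $e$. For $x\in L$, the right inverse $x^\rho$ and left inverse $x^\lambda$ are the elements with $x x^\rho=e^\rho$ and $x^\lambda x=e^\lambda$, where $e^\rho$ and $e^\lambda$ denote a right identity element and a left identity element of $L$ (assumed to exist whenever $x^\rho$, respectively $x^\lambda$, is used; both equal $e$ in a loop). $AUM(L)$ is the automorphism group of $(L,\cdot)$. The holomorph $H(L)=(H,\circ)$ is the set $H$ of pairs $(\alpha,x)$, $\alpha\in AUM(L)$, $x\in L$, with operation $(\alpha,x)\circ(\beta,y)=(\alpha\beta,\,x\beta\cdot y)$. A quasigroup (loop) is an automorphic inverse property quasigroup, AIPQ (loop, AIPL), if and only if it obeys the identity $(xy)^\rho=x^\rho y^\rho$ or $(xy)^\lambda=x^\lambda y^\lambda$. A quasigroup (loop) is a cross inverse property quasigroup, CIPQ (loop, CIPL), if and only if it obeys one of the (equivalent) identities $xy\cdot x^\rho=y$, or $x\cdot yx^\rho=y$, or $x^\lambda\cdot(yx)=y$, or $x^\lambda y\cdot x=y$. Here juxtaposition binds more tightly than $\cdot$. *)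

theory Defs
  imports "HOL-Algebra.Bij"
begin

text \<open>
  Quasigroups use only the \<open>carrier\<close> and \<open>mult\<close> fields of the monoid record, as do \<open>hom\<close>,
  \<open>auto\<close>, \<open>iso\<close> and \<open>\<cong>\<close>; the field \<open>one\<close> is unconstrained for a quasigroup and is the
  two-sided identity for a loop.
\<close>

locale quasigroup =
  fixes G (structure)
  assumes nonempty: "carrier G \<noteq> {}"
    and m_closed: "\<lbrakk>a \<in> carrier G; b \<in> carrier G\<rbrakk> \<Longrightarrow> a \<otimes> b \<in> carrier G"
    and ex1_right_factor: "\<lbrakk>a \<in> carrier G; b \<in> carrier G\<rbrakk> \<Longrightarrow> \<exists>!x. x \<in> carrier G \<and> a \<otimes> x = b"
    and ex1_left_factor: "\<lbrakk>a \<in> carrier G; b \<in> carrier G\<rbrakk> \<Longrightarrow> \<exists>!y. y \<in> carrier G \<and> y \<otimes> a = b"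

locale loop = quasigroup +
  assumes one_closed: "\<one> \<in> carrier G"
    and l_one: "x \<in> carrier G \<Longrightarrow> \<one> \<otimes> x = x"
    and r_one: "x \<in> carrier G \<Longrightarrow> x \<otimes> \<one> = x"

definition is_right_identity :: "('a, 'b) monoid_scheme \<Rightarrow> 'a \<Rightarrow> bool" where
  "is_right_identity G e \<longleftrightarrow> e \<in> carrier G \<and> (\<forall>x\<in>carrier G. x \<otimes>\<^bsub>G\<^esub> e = x)"

definition is_left_identity :: "('a, 'b) monoid_scheme \<Rightarrow> 'a \<Rightarrow> bool" where
  "is_left_identity G e \<longleftrightarrow> e \<in> carrier G \<and> (\<forall>x\<in>carrier G. e \<otimes>\<^bsub>G\<^esub> x = x)"

text \<open>
  A quasigroup has at most one right (left) identity, but it may have none. The inverses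
  below are meaningful only if the corresponding one-sided identity exists, so every property
  that mentions them also asserts that existence.
\<close>

definition right_inverse :: "('a, 'b) monoid_scheme \<Rightarrow> 'a \<Rightarrow> 'a" where
  "right_inverse G x = (THE y. y \<in> carrier G \<and> x \<otimes>\<^bsub>G\<^esub> y = (THE e. is_right_identity G e))"

definition left_inverse :: "('a, 'b) monoid_scheme \<Rightarrow> 'a \<Rightarrow> 'a" where
  "left_inverse G x = (THE y. y \<in> carrier G \<and> y \<otimes>\<^bsub>G\<^esub> x = (THE e. is_left_identity G e))"

definition automorphic_inverse_property :: "('a, 'b) monoid_scheme \<Rightarrow> bool" where
  "automorphic_inverse_property G \<longleftrightarrow>
     ((\<exists>e. is_right_identity G e) \<and>
      (\<forall>x\<in>carrier G. \<forall>y\<in>carrier G.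
         right_inverse G (x \<otimes>\<^bsub>G\<^esub> y) = right_inverse G x \<otimes>\<^bsub>G\<^esub> right_inverse G y)) \<or>
     ((\<exists>e. is_left_identity G e) \<and>
      (\<forall>x\<in>carrier G. \<forall>y\<in>carrier G.
         left_inverse G (x \<otimes>\<^bsub>G\<^esub> y) = left_inverse G x \<otimes>\<^bsub>G\<^esub> left_inverse G y))"

definition cross_inverse_property :: "('a, 'b) monoid_scheme \<Rightarrow> bool" where
  "cross_inverse_property G \<longleftrightarrow>
     ((\<exists>e. is_right_identity G e) \<and>
      ((\<forall>x\<in>carrier G. \<forall>y\<in>carrier G. (x \<otimes>\<^bsub>G\<^esub> y) \<otimes>\<^bsub>G\<^esub> right_inverse G x = y) \<or>
       (\<forall>x\<in>carrier G. \<forall>y\<in>carrier G. x \<otimes>\<^bsub>G\<^esub> (y \<otimes>\<^bsub>G\<^esub> right_inverse G x) = y))) \<or>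
     ((\<exists>e. is_left_identity G e) \<and>
      ((\<forall>x\<in>carrier G. \<forall>y\<in>carrier G. left_inverse G x \<otimes>\<^bsub>G\<^esub> (y \<otimes>\<^bsub>G\<^esub> x) = y) \<or>
       (\<forall>x\<in>carrier G. \<forall>y\<in>carrier G. (left_inverse G x \<otimes>\<^bsub>G\<^esub> y) \<otimes>\<^bsub>G\<^esub> x = y)))"

definition AIPQ :: "('a, 'b) monoid_scheme \<Rightarrow> bool" where
  "AIPQ G \<longleftrightarrow> quasigroup G \<and> automorphic_inverse_property G"

definition AIPL :: "('a, 'b) monoid_scheme \<Rightarrow> bool" where
  "AIPL G \<longleftrightarrow> loop G \<and> automorphic_inverse_property G"

definition CIPQ :: "('a, 'b) monoid_scheme \<Rightarrow> bool" where
  "CIPQ G \<longleftrightarrow> quasigroup G \<and> cross_inverse_property G"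

definition CIPL :: "('a, 'b) monoid_scheme \<Rightarrow> bool" where
  "CIPL G \<longleftrightarrow> loop G \<and> cross_inverse_property G"

text \<open>
  Mappings act on the right in \<open>(\<alpha>, x) \<circ> (\<beta>, y) = (\<alpha>\<beta>, x\<beta> \<cdot> y)\<close>, so \<open>\<alpha>\<beta>\<close> applies \<open>\<alpha>\<close> first
  and is \<open>compose (carrier G) \<beta> \<alpha>\<close>, while \<open>x\<beta>\<close> is \<open>\<beta> x\<close>. The elements of \<open>auto G\<close> are
  extensional on the carrier, so equality in it is equality of maps on the carrier.
\<close>

definition holomorph :: "('a, 'b) monoid_scheme \<Rightarrow> (('a \<Rightarrow> 'a) \<times> 'a) monoid" where
  "holomorph G =
     \<lparr>carrier = auto G \<times> carrier G,
      mult = (\<lambda>(\<alpha>, x) (\<beta>, y). (compose (carrier G) \<beta> \<alpha>, \<beta> x \<otimes>\<^bsub>G\<^esub> y)),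
      one = (\<lambda>x\<in>carrier G. x, \<one>\<^bsub>G\<^esub>)\<rparr>"

end

theory Submission
  imports Defs
begin

text \<open>
  Each of the hypotheses forces every automorphism of \<open>L\<close> to be the identity map \<open>\<epsilon>\<close>. Then the
  elements of \<open>H(L)\<close> are the pairs \<open>(\<epsilon>, x)\<close>, they multiply as the \<open>x\<close> do, and the second
  projection is an isomorphism onto \<open>L\<close>.

  Under the cross inverse property of \<open>H(L)\<close>, it is enough to see where \<open>\<beta>\<close> acts. In each of the four
  identities the free variable \<open>(\<beta>, y)\<close> has a factor \<open>(\<epsilon>, z)\<close> on its left, with \<open>z\<close> arbitrary: in
  the identities with right inverses that factor is arbitrary from the start, and in those with
  left inverses it is so because every element is a left inverse (\<open>cross_inverse_partner\<close>). The
  second component of the product depends on \<open>z\<close> and \<open>\<beta>\<close> only through \<open>z\<beta>\<close>, injectively. The other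
  side has the second component \<open>y\<close>, which does not depend on \<open>\<beta>\<close>, so replacing \<open>\<beta>\<close> by \<open>\<epsilon>\<close> and
  cancelling gives \<open>z\<beta> = z\<close> (\<open>CIPQ_holomorph_fixes\<close>).

  For the automorphic inverse property, let \<open>e\<close> be the one-sided identity and let \<open>w \<in> L\<close> be
  arbitrary; it is the inverse of some \<open>y\<close>. The property is applied to the two elements \<open>(\<alpha>, e)\<close> and
  \<open>(\<epsilon>, y)\<close>, whose inverses are \<open>(\<gamma>, e)\<close> and \<open>(\<epsilon>, w)\<close>, where \<open>\<gamma>\<close> is inverse to \<open>\<alpha>\<close>. It says that the
  product of the inverses is an inverse of the product, which comes down to \<open>y \<cdot> w\<gamma> = y \<cdot> w\<close> for
  right inverses and to \<open>w\<alpha> \<cdot> y = w \<cdot> y\<close> for left ones (\<open>AIPQ_holomorph_fixes\<close>).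

  A one-sided identity of \<open>H(L)\<close> is necessarily \<open>(\<epsilon>, e)\<close> with \<open>e\<close> a one-sided identity of \<open>L\<close> on the
  same side. The statement about loops is an instance of the one about quasigroups.
\<close>

section \<open>Cancellation and one-sided inverses in quasigroups\<close>

context quasigroup
begin

lemma left_cancel:
  "\<lbrakk>a \<in> carrier G; x \<in> carrier G; y \<in> carrier G; a \<otimes> x = a \<otimes> y\<rbrakk> \<Longrightarrow> x = y"
  using ex1_right_factor m_closed by metis

lemma right_cancel:
  "\<lbrakk>a \<in> carrier G; x \<in> carrier G; y \<in> carrier G; x \<otimes> a = y \<otimes> a\<rbrakk> \<Longrightarrow> x = y"
  using ex1_left_factor m_closed by metis

lemma The_right_identity:
  assumes "is_right_identity G e"
  shows "(THE e. is_right_identity G e) = e"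
proof (rule the_equality[where P = "is_right_identity G", OF assms])
  fix f assume "is_right_identity G f"
  with assms show "f = e"
    unfolding is_right_identity_def using left_cancel by metis
qed

lemma The_left_identity:
  assumes "is_left_identity G e"
  shows "(THE e. is_left_identity G e) = e"
proof (rule the_equality[where P = "is_left_identity G", OF assms])
  fix f assume "is_left_identity G f"
  with assms show "f = e"
    unfolding is_left_identity_def using right_cancel by metis
qed

lemma right_inverse:
  assumes "is_right_identity G e" "x \<in> carrier G"
  shows "right_inverse G x \<in> carrier G" "x \<otimes> right_inverse G x = e"
proof -
  have "e \<in> carrier G"
    using assms(1) by (simp add: is_right_identity_def)
  then have "right_inverse G x \<in> carrier G \<and> x \<otimes> right_inverse G x = e"
    unfolding right_inverse_def The_right_identity[OF assms(1)]
    using theI'[OF ex1_right_factor] assms(2) by blast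
  then show "right_inverse G x \<in> carrier G" "x \<otimes> right_inverse G x = e"
    by auto
qed

lemma left_inverse:
  assumes "is_left_identity G e" "x \<in> carrier G"
  shows "left_inverse G x \<in> carrier G" "left_inverse G x \<otimes> x = e"
proof -
  have "e \<in> carrier G"
    using assms(1) by (simp add: is_left_identity_def)
  then have "left_inverse G x \<in> carrier G \<and> left_inverse G x \<otimes> x = e"
    unfolding left_inverse_def The_left_identity[OF assms(1)]
    using theI'[OF ex1_left_factor] assms(2) by blast
  then show "left_inverse G x \<in> carrier G" "left_inverse G x \<otimes> x = e"
    by auto
qed

lemma right_inverse_eqI:
  assumes "is_right_identity G e" "x \<in> carrier G" "y \<in> carrier G" "x \<otimes> y = e"
  shows "right_inverse G x = y"
  using right_inverse[OF assms(1,2)] assms left_cancel by metis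

lemma left_inverse_eqI:
  assumes "is_left_identity G e" "x \<in> carrier G" "y \<in> carrier G" "y \<otimes> x = e"
  shows "left_inverse G x = y"
  using left_inverse[OF assms(1,2)] assms right_cancel by metis

lemma left_inverse_surj:
  assumes "is_left_identity G e" "k \<in> carrier G"
  obtains h where "h \<in> carrier G" "left_inverse G h = k"
proof -
  have "e \<in> carrier G"
    using assms(1) by (simp add: is_left_identity_def)
  then obtain h where "h \<in> carrier G" "k \<otimes> h = e"
    using ex1_right_factor[OF assms(2)] by blast
  then show ?thesis
    using that left_inverse_eqI[OF assms(1) _ assms(2)] by blast
qed

end

section \<open>Automorphisms and the holomorph\<close>

lemma auto_closed: "\<lbrakk>\<alpha> \<in> auto L; x \<in> carrier L\<rbrakk> \<Longrightarrow> \<alpha> x \<in> carrier L"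
  by (auto simp: auto_def hom_def)

lemma auto_mult:
  "\<lbrakk>\<alpha> \<in> auto L; x \<in> carrier L; y \<in> carrier L\<rbrakk> \<Longrightarrow> \<alpha> (x \<otimes>\<^bsub>L\<^esub> y) = \<alpha> x \<otimes>\<^bsub>L\<^esub> \<alpha> y"
  by (auto simp: auto_def hom_def)

lemma auto_extensional: "\<alpha> \<in> auto L \<Longrightarrow> \<alpha> \<in> extensional (carrier L)"
  by (simp add: auto_def Bij_def)

lemma auto_inj: "\<lbrakk>\<alpha> \<in> auto L; x \<in> carrier L; y \<in> carrier L; \<alpha> x = \<alpha> y\<rbrakk> \<Longrightarrow> x = y"
  by (auto simp: auto_def Bij_def bij_betw_def dest: inj_onD)

lemma (in quasigroup) identity_in_auto: "(\<lambda>x\<in>carrier G. x) \<in> auto G"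
  by (auto simp: auto_def hom_def m_closed id_Bij)

lemma auto_compose_identity:
  assumes "\<alpha> \<in> auto L"
  shows "compose (carrier L) \<alpha> (\<lambda>x\<in>carrier L. x) = \<alpha>"
    and "compose (carrier L) (\<lambda>x\<in>carrier L. x) \<alpha> = \<alpha>"
proof -
  have "\<alpha> \<in> carrier L \<rightarrow> carrier L"
    using auto_closed[OF assms] by blast
  then show "compose (carrier L) \<alpha> (\<lambda>x\<in>carrier L. x) = \<alpha>"
    and "compose (carrier L) (\<lambda>x\<in>carrier L. x) \<alpha> = \<alpha>"
    using auto_extensional[OF assms] by (rule compose_Id Id_compose)+
qed

lemma carrier_holomorph [simp]: "carrier (holomorph L) = auto L \<times> carrier L"
  by (simp add: holomorph_def)

lemma mult_holomorph [simp]: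
  "(\<alpha>, x) \<otimes>\<^bsub>holomorph L\<^esub> (\<beta>, y) = (compose (carrier L) \<beta> \<alpha>, \<beta> x \<otimes>\<^bsub>L\<^esub> y)"
  by (simp add: holomorph_def)

text \<open>
  The first component must be \<open>\<epsilon>\<close> since composing it with \<open>\<epsilon>\<close> gives \<open>\<epsilon>\<close>, and multiplying by the
  elements \<open>(\<epsilon>, x)\<close> then shows what the second component is.
\<close>

lemma holomorph_right_identity:
  assumes "quasigroup L" "is_right_identity (holomorph L) h"
  obtains e where "h = (\<lambda>x\<in>carrier L. x, e)" "is_right_identity L e"
proof -
  interpret quasigroup L by fact
  obtain \<epsilon> e where h: "h = (\<epsilon>, e)" by fastforce
  then have mem: "\<epsilon> \<in> auto L" "e \<in> carrier L"
    and id: "\<And>\<alpha> x. \<lbrakk>\<alpha> \<in> auto L; x \<in> carrier L\<rbrakk> \<Longrightarrow>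
               compose (carrier L) \<epsilon> \<alpha> = \<alpha> \<and> \<epsilon> x \<otimes>\<^bsub>L\<^esub> e = x"
    using assms(2) by (auto simp: is_right_identity_def)
  have "compose (carrier L) \<epsilon> (\<lambda>x\<in>carrier L. x) = (\<lambda>x\<in>carrier L. x)"
    using id identity_in_auto mem(2) by blast
  then have \<epsilon>: "\<epsilon> = (\<lambda>x\<in>carrier L. x)"
    by (simp add: auto_compose_identity[OF mem(1)])
  moreover from \<epsilon> have "is_right_identity L e"
    using id[OF identity_in_auto] mem(2) by (auto simp: is_right_identity_def)
  ultimately show ?thesis using that h by blast
qed

lemma holomorph_left_identity:
  assumes "quasigroup L" "is_left_identity (holomorph L) h"
  obtains e where "h = (\<lambda>x\<in>carrier L. x, e)" "is_left_identity L e"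
proof -
  interpret quasigroup L by fact
  obtain \<epsilon> e where h: "h = (\<epsilon>, e)" by fastforce
  then have mem: "\<epsilon> \<in> auto L" "e \<in> carrier L"
    and id: "\<And>\<alpha> x. \<lbrakk>\<alpha> \<in> auto L; x \<in> carrier L\<rbrakk> \<Longrightarrow>
               compose (carrier L) \<alpha> \<epsilon> = \<alpha> \<and> \<alpha> e \<otimes>\<^bsub>L\<^esub> x = x"
    using assms(2) by (auto simp: is_left_identity_def)
  have "compose (carrier L) (\<lambda>x\<in>carrier L. x) \<epsilon> = (\<lambda>x\<in>carrier L. x)"
    using id identity_in_auto mem(2) by blast
  then have "\<epsilon> = (\<lambda>x\<in>carrier L. x)"
    by (simp add: auto_compose_identity[OF mem(1)])
  moreover have "is_left_identity L e"
    using id[OF identity_in_auto] mem(2) by (auto simp: is_left_identity_def)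
  ultimately show ?thesis using that h by blast
qed

lemma holomorph_iso_if_autos_trivial:
  assumes "quasigroup L"
    and triv: "\<And>\<alpha> x. \<lbrakk>\<alpha> \<in> auto L; x \<in> carrier L\<rbrakk> \<Longrightarrow> \<alpha> x = x"
  shows "holomorph L \<cong> L"
proof -
  interpret quasigroup L by fact
  have "\<alpha> = (\<lambda>x\<in>carrier L. x)" if "\<alpha> \<in> auto L" for \<alpha>
    using auto_extensional[OF that] triv[OF that]
    by (auto simp: fun_eq_iff extensional_def)
  then have "auto L = {\<lambda>x\<in>carrier L. x}"
    using identity_in_auto by blast
  then have "bij_betw snd (carrier (holomorph L)) (carrier L)"
    by (auto simp: bij_betw_def inj_on_def image_iff)
  moreover have "snd \<in> hom (holomorph L) L"
    by (auto simp: hom_def triv)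
  ultimately show ?thesis
    by (auto simp: is_iso_def iso_def)
qed

section \<open>The cross inverse property\<close>

text \<open>
  The identities \<open>xy \<cdot> x\<^sup>\<rho> = y\<close> and \<open>x\<^sup>\<lambda>y \<cdot> x = y\<close> have the same shape, and so have \<open>x \<cdot> yx\<^sup>\<rho> = y\<close> and
  \<open>x\<^sup>\<lambda> \<cdot> yx = y\<close>. The factor to the left of \<open>y\<close> can be any element \<open>k\<close>: in the latter identity of
  each pair this is because every \<open>k\<close> is the left inverse of some element. Forgetting how the factor
  \<open>h\<close> to the right of \<open>y\<close> depends on \<open>k\<close> reduces the four identities to two.
\<close>

lemma (in quasigroup) cross_inverse_partner:
  assumes "cross_inverse_property G" "k \<in> carrier G"
  obtains h where "h \<in> carrier G"
    "(\<forall>y\<in>carrier G. (k \<otimes> y) \<otimes> h = y) \<or> (\<forall>y\<in>carrier G. k \<otimes> (y \<otimes> h) = y)"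
proof (cases "\<exists>e. is_right_identity G e \<and>
    ((\<forall>x\<in>carrier G. \<forall>y\<in>carrier G. (x \<otimes> y) \<otimes> right_inverse G x = y) \<or>
     (\<forall>x\<in>carrier G. \<forall>y\<in>carrier G. x \<otimes> (y \<otimes> right_inverse G x) = y))")
  case True
  then obtain e where "is_right_identity G e" by blast
  then have "right_inverse G k \<in> carrier G"
    using right_inverse(1) assms(2) by blast
  then show ?thesis
    using True assms(2) that by blast
next
  case False
  with assms(1) obtain e where e: "is_left_identity G e"
    and id: "(\<forall>x\<in>carrier G. \<forall>y\<in>carrier G. left_inverse G x \<otimes> (y \<otimes> x) = y) \<or>
             (\<forall>x\<in>carrier G. \<forall>y\<in>carrier G. (left_inverse G x \<otimes> y) \<otimes> x = y)"
    unfolding cross_inverse_property_def by blast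
  obtain h where "h \<in> carrier G" "left_inverse G h = k"
    using left_inverse_surj[OF e assms(2)] .
  then show ?thesis
    using id that by blast
qed

lemma CIPQ_holomorph_fixes:
  assumes "quasigroup L" "CIPQ (holomorph L)" and \<beta>: "\<beta> \<in> auto L" and z: "z \<in> carrier L"
  shows "\<beta> z = z"
proof -
  interpret quasigroup L by fact
  interpret H: quasigroup "holomorph L"
    using assms(2) by (simp add: CIPQ_def)
  define \<epsilon> where "\<epsilon> = (\<lambda>x\<in>carrier L. x)"
  have \<epsilon>: "\<epsilon> \<in> auto L"
    unfolding \<epsilon>_def by (rule identity_in_auto)
  have "cross_inverse_property (holomorph L)" "(\<epsilon>, z) \<in> carrier (holomorph L)"
    using assms(2) \<epsilon> z by (simp_all add: CIPQ_def)
  then obtain h where h: "h \<in> carrier (holomorph L)"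
    and h_partner:
      "(\<forall>k\<in>carrier (holomorph L).
          ((\<epsilon>, z) \<otimes>\<^bsub>holomorph L\<^esub> k) \<otimes>\<^bsub>holomorph L\<^esub> h = k) \<or>
       (\<forall>k\<in>carrier (holomorph L).
          (\<epsilon>, z) \<otimes>\<^bsub>holomorph L\<^esub> (k \<otimes>\<^bsub>holomorph L\<^esub> h) = k)"
    by (rule H.cross_inverse_partner)
  obtain \<gamma> c where hc: "h = (\<gamma>, c)" by fastforce
  with h have \<gamma>: "\<gamma> \<in> auto L" and c: "c \<in> carrier L" by auto
  have partner:
      "(\<forall>k\<in>carrier (holomorph L).
          ((\<epsilon>, z) \<otimes>\<^bsub>holomorph L\<^esub> k) \<otimes>\<^bsub>holomorph L\<^esub> (\<gamma>, c) = k) \<or>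
       (\<forall>k\<in>carrier (holomorph L).
          (\<epsilon>, z) \<otimes>\<^bsub>holomorph L\<^esub> (k \<otimes>\<^bsub>holomorph L\<^esub> (\<gamma>, c)) = k)"
    using h_partner unfolding hc .
  have closed: "\<beta> z \<in> carrier L" "\<gamma> z \<in> carrier L" "\<gamma> (\<beta> z) \<in> carrier L"
    using \<beta> \<gamma> z auto_closed by metis+
  \<comment> \<open>The identity is compared at \<open>(\<beta>, y)\<close> and \<open>(\<epsilon>, y)\<close> with \<open>y = z\<close>, an element at hand.\<close>
  from partner show ?thesis
  proof
    assume *: "\<forall>k\<in>carrier (holomorph L).
      ((\<epsilon>, z) \<otimes>\<^bsub>holomorph L\<^esub> k) \<otimes>\<^bsub>holomorph L\<^esub> (\<gamma>, c) = k"
    have "\<gamma> (\<beta> z \<otimes>\<^bsub>L\<^esub> z) \<otimes>\<^bsub>L\<^esub> c = z"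
      using *[rule_format, of "(\<beta>, z)"] \<beta> z by simp
    moreover have "\<gamma> (z \<otimes>\<^bsub>L\<^esub> z) \<otimes>\<^bsub>L\<^esub> c = z"
      using *[rule_format, of "(\<epsilon>, z)"] \<epsilon> z by (simp add: \<epsilon>_def)
    ultimately have "\<gamma> (\<beta> z \<otimes>\<^bsub>L\<^esub> z) = \<gamma> (z \<otimes>\<^bsub>L\<^esub> z)"
      using right_cancel[OF c] auto_closed[OF \<gamma>] m_closed closed(1) z by metis
    then have "\<beta> z \<otimes>\<^bsub>L\<^esub> z = z \<otimes>\<^bsub>L\<^esub> z"
      using auto_inj[OF \<gamma>] m_closed closed(1) z by blast
    then show ?thesis
      using right_cancel z closed(1) by blast
  next
    assume *: "\<forall>k\<in>carrier (holomorph L).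
      (\<epsilon>, z) \<otimes>\<^bsub>holomorph L\<^esub> (k \<otimes>\<^bsub>holomorph L\<^esub> (\<gamma>, c)) = k"
    have "\<gamma> (\<beta> z) \<otimes>\<^bsub>L\<^esub> (\<gamma> z \<otimes>\<^bsub>L\<^esub> c) = z"
      using *[rule_format, of "(\<beta>, z)"] \<beta> z by (simp add: compose_eq)
    moreover have "\<gamma> z \<otimes>\<^bsub>L\<^esub> (\<gamma> z \<otimes>\<^bsub>L\<^esub> c) = z"
      using *[rule_format, of "(\<epsilon>, z)"] \<epsilon> z by (simp add: \<epsilon>_def compose_eq)
    ultimately have "\<gamma> (\<beta> z) = \<gamma> z"
      using right_cancel[of "\<gamma> z \<otimes>\<^bsub>L\<^esub> c" "\<gamma> (\<beta> z)" "\<gamma> z"] m_closed c closed by simp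
    then show ?thesis
      using auto_inj[OF \<gamma>] closed(1) z by blast
  qed
qed

section \<open>The automorphic inverse property\<close>

text \<open>
  The order of \<open>(\<alpha>, e)\<close> and \<open>(\<epsilon>, y)\<close> is chosen so that \<open>e\<close> always ends up on the side on which it
  is an identity.
\<close>

lemma AIPQ_holomorph_fixes:
  assumes "quasigroup L" "AIPQ (holomorph L)" and \<alpha>: "\<alpha> \<in> auto L" and w: "w \<in> carrier L"
  shows "\<alpha> w = w"
proof -
  interpret quasigroup L by fact
  interpret H: quasigroup "holomorph L"
    using assms(2) by (simp add: AIPQ_def)
  define \<epsilon> where "\<epsilon> = (\<lambda>x\<in>carrier L. x)"
  have \<epsilon>: "\<epsilon> \<in> auto L"
    unfolding \<epsilon>_def by (rule identity_in_auto)
  have \<epsilon>_id: "compose (carrier L) \<epsilon> \<beta> = \<beta>" "compose (carrier L) \<beta> \<epsilon> = \<beta>" if "\<beta> \<in> auto L" for \<beta>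
    unfolding \<epsilon>_def by (fact auto_compose_identity[OF that])+
  have \<epsilon>_app: "\<epsilon> x = x" if "x \<in> carrier L" for x
    using that by (simp add: \<epsilon>_def)
  have "automorphic_inverse_property (holomorph L)"
    using assms(2) by (simp add: AIPQ_def)
  then show ?thesis
    unfolding automorphic_inverse_property_def
  proof (elim disjE conjE exE)
    fix i
    assume i: "is_right_identity (holomorph L) i"
      and aip: "\<forall>h\<in>carrier (holomorph L). \<forall>k\<in>carrier (holomorph L).
        right_inverse (holomorph L) (h \<otimes>\<^bsub>holomorph L\<^esub> k) =
        right_inverse (holomorph L) h \<otimes>\<^bsub>holomorph L\<^esub> right_inverse (holomorph L) k"
    obtain e where ie: "i = (\<epsilon>, e)" and e: "is_right_identity L e"
      unfolding \<epsilon>_def using holomorph_right_identity[OF assms(1) i] .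
    have ec: "e \<in> carrier L" and r_id: "\<And>x. x \<in> carrier L \<Longrightarrow> x \<otimes>\<^bsub>L\<^esub> e = x"
      using e by (auto simp: is_right_identity_def)
    obtain y where y: "y \<in> carrier L" "y \<otimes>\<^bsub>L\<^esub> w = e"
      using ex1_left_factor[OF w ec] by blast
    obtain \<gamma> z where \<gamma>z: "right_inverse (holomorph L) (\<alpha>, e) = (\<gamma>, z)" by fastforce
    have \<gamma>: "\<gamma> \<in> auto L" and z: "z \<in> carrier L"
      and \<alpha>\<gamma>: "compose (carrier L) \<gamma> \<alpha> = \<epsilon>" and "\<gamma> e \<otimes>\<^bsub>L\<^esub> z = e"
      using H.right_inverse[OF i, of "(\<alpha>, e)"] \<alpha> ec \<gamma>z ie by auto
    have \<gamma>\<alpha>: "\<gamma> (\<alpha> x) = x" if "x \<in> carrier L" for x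
      using fun_cong[OF \<alpha>\<gamma>, of x] that by (simp add: compose_eq \<epsilon>_app)
    have fix_e: "\<beta> e = e" if "\<beta> \<in> auto L" for \<beta>
      using auto_mult[OF that ec ec] r_id left_cancel[of "\<beta> e" "\<beta> e" e] ec auto_closed[OF that]
      by auto
    have "z = e"
      using \<open>\<gamma> e \<otimes>\<^bsub>L\<^esub> z = e\<close> left_cancel[OF ec z ec] fix_e[OF \<gamma>] r_id[OF ec] by simp
    have inv_y: "right_inverse (holomorph L) (\<epsilon>, y) = (\<epsilon>, w)"
      using H.right_inverse_eqI[OF i, of "(\<epsilon>, y)" "(\<epsilon>, w)"] \<epsilon> y w ie
      by (simp add: \<epsilon>_id \<epsilon>_app)
    have "right_inverse (holomorph L) (\<alpha>, \<alpha> y) = (\<gamma>, \<gamma> w)"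
      using aip[rule_format, of "(\<epsilon>, y)" "(\<alpha>, e)"] \<alpha> \<epsilon> y(1) ec
      by (simp add: \<gamma>z inv_y \<open>z = e\<close> \<epsilon>_id \<alpha> \<gamma> y(1) w r_id auto_closed)
    then have "\<gamma> (\<alpha> y) \<otimes>\<^bsub>L\<^esub> \<gamma> w = e"
      using H.right_inverse(2)[OF i, of "(\<alpha>, \<alpha> y)"] \<alpha> y ie by (simp add: auto_closed)
    then have "y \<otimes>\<^bsub>L\<^esub> \<gamma> w = y \<otimes>\<^bsub>L\<^esub> w"
      unfolding \<gamma>\<alpha>[OF y(1)] y(2) .
    then have "\<gamma> w = w"
      by (rule left_cancel[OF y(1) auto_closed[OF \<gamma> w] w])
    then have "\<gamma> (\<alpha> w) = \<gamma> w"
      using \<gamma>\<alpha>[OF w] by simp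
    then show ?thesis
      using auto_inj[OF \<gamma>] auto_closed[OF \<alpha> w] w by blast
  next
    fix i
    assume i: "is_left_identity (holomorph L) i"
      and aip: "\<forall>h\<in>carrier (holomorph L). \<forall>k\<in>carrier (holomorph L).
        left_inverse (holomorph L) (h \<otimes>\<^bsub>holomorph L\<^esub> k) =
        left_inverse (holomorph L) h \<otimes>\<^bsub>holomorph L\<^esub> left_inverse (holomorph L) k"
    obtain e where ie: "i = (\<epsilon>, e)" and e: "is_left_identity L e"
      unfolding \<epsilon>_def using holomorph_left_identity[OF assms(1) i] .
    have ec: "e \<in> carrier L" and l_id: "\<And>x. x \<in> carrier L \<Longrightarrow> e \<otimes>\<^bsub>L\<^esub> x = x"
      using e by (auto simp: is_left_identity_def)
    obtain y where y: "y \<in> carrier L" "w \<otimes>\<^bsub>L\<^esub> y = e"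
      using ex1_right_factor[OF w ec] by blast
    obtain \<gamma> z where \<gamma>z: "left_inverse (holomorph L) (\<alpha>, e) = (\<gamma>, z)" by fastforce
    have \<gamma>: "\<gamma> \<in> auto L" and z: "z \<in> carrier L" and "\<alpha> z \<otimes>\<^bsub>L\<^esub> e = e"
      using H.left_inverse[OF i, of "(\<alpha>, e)"] \<alpha> ec \<gamma>z ie by auto
    have fix_e: "\<beta> e = e" if "\<beta> \<in> auto L" for \<beta>
      using auto_mult[OF that ec ec] l_id right_cancel[of "\<beta> e" "\<beta> e" e] ec auto_closed[OF that]
      by auto
    have "\<alpha> z = \<alpha> e"
      using \<open>\<alpha> z \<otimes>\<^bsub>L\<^esub> e = e\<close> right_cancel[OF ec _ ec] auto_closed[OF \<alpha> z] fix_e[OF \<alpha>]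
        l_id[OF ec] by simp
    then have "z = e"
      using auto_inj[OF \<alpha> z ec] by blast
    have inv_y: "left_inverse (holomorph L) (\<epsilon>, y) = (\<epsilon>, w)"
      using H.left_inverse_eqI[OF i, of "(\<epsilon>, y)" "(\<epsilon>, w)"] \<epsilon> y w ie
      by (simp add: \<epsilon>_id \<epsilon>_app)
    have "left_inverse (holomorph L) (\<alpha>, y) = (\<gamma>, w)"
      using aip[rule_format, of "(\<alpha>, e)" "(\<epsilon>, y)"] \<alpha> \<epsilon> y(1) ec
      by (simp add: \<gamma>z inv_y \<open>z = e\<close> \<epsilon>_id \<epsilon>_app \<alpha> \<gamma> y(1) w ec l_id)
    then have "\<alpha> w \<otimes>\<^bsub>L\<^esub> y = e"
      using H.left_inverse(2)[OF i, of "(\<alpha>, y)"] \<alpha> y ie by simp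
    then have "\<alpha> w \<otimes>\<^bsub>L\<^esub> y = w \<otimes>\<^bsub>L\<^esub> y"
      unfolding y(2) .
    then show ?thesis
      by (rule right_cancel[OF y(1) auto_closed[OF \<alpha> w] w])
  qed
qed

section \<open>Holomorphs with an automorphic or cross inverse property\<close>

theorem corollary2p2:
  fixes L :: "('a, 'b) monoid_scheme"
  shows "(quasigroup L \<and> (AIPQ (holomorph L) \<or> CIPQ (holomorph L)) \<longrightarrow> holomorph L \<cong> L) \<and>
         (loop L \<and> (AIPL (holomorph L) \<or> CIPL (holomorph L)) \<longrightarrow> holomorph L \<cong> L)"
proof -
  have quasi: "holomorph L \<cong> L"
    if "quasigroup L" "AIPQ (holomorph L) \<or> CIPQ (holomorph L)"
    using that holomorph_iso_if_autos_trivial AIPQ_holomorph_fixes CIPQ_holomorph_fixes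
    by metis
  have "AIPL (holomorph L) \<Longrightarrow> AIPQ (holomorph L)" "CIPL (holomorph L) \<Longrightarrow> CIPQ (holomorph L)"
    by (simp_all add: AIPL_def AIPQ_def CIPL_def CIPQ_def loop_def)
  with quasi show ?thesis
    by (auto simp: loop_def)
qed

end
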